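(* For every $s\in(0,\infty)$ the random variable $Y_s$ has a density $f_s(t):=\P(Y_s\in \mathrm{d}t)/\mathrm{d}t$ on $(0,\infty)$ given by $$ f_s(t)=\frac{s\,t^{s-1}e^{-\gamma s}}{\Gamma(s+1)}\quad\text{for } t\in(0,1],$$ $$ f_s(t)=\frac{s\,t^{s-1}e^{-\gamma s}}{\Gamma(s+1)}-s\,t^{s-1}\int_0^{t-1}\frac{f_s(a)}{(1+a)^s}\,\mathrm{d}a\quad\text{for } t\in(1,\infty).$$
   Context: The Dickman subordinator $Y=(Y_s)_{s\ge0}$ is the pure-jump subordinator (increasing Lévy process, zero drift) with Lévy measure $\nu(\mathrm{d}t)=\frac{1}{t}\mathbf 1_{(0,1)}(t)\,\mathrm{d}t$, i.e. $\mathbb E[e^{\lambda Y_s}]=\exp\{s\int_0^1(e^{\lambda t}-1)\frac{\mathrm{d}t}{t}\}$. $\Gamma$ is Euler's gamma function and $\gamma=-\int_0^\infty \log u\,e^{-u}\,\mathrm{d}u$ is the Euler–Mascheroni constant. *)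

theory Defs
  imports "HOL-Probability.Probability"
begin

end

theory Submission
  imports Defs
begin

text \<open>
  Let \<open>\<mu>\<close> be the law of \<open>Y\<close>. Differentiating the Laplace transform shows that
  \<open>E[Y e\<^sup>-\<^sup>l\<^sup>Y] = s E[e\<^sup>-\<^sup>l\<^sup>U] E[e\<^sup>-\<^sup>l\<^sup>Y]\<close> with \<open>U\<close> uniform on \<open>(0,1)\<close>, and by uniqueness of Laplace transforms
  \<open>y \<mu>(dy) = s \<mu>(y - 1, y) dy\<close>. As \<open>\<mu>\<close> lives on \<open>(0,\<infinity>)\<close>, it has the density
  \<open>f(t) = s (F(t) - F(t - 1)) / t\<close>, where \<open>F\<close> is the distribution function. Hence \<open>F(t) t\<^sup>-\<^sup>s\<close> is constant on
  \<open>(0,1]\<close>, and \<open>(F(t) - F(t - 1)) t\<^sup>-\<^sup>s\<close> has derivative \<open>- f(t - 1) t\<^sup>-\<^sup>s\<close> for \<open>t > 1\<close>, which is the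
  recursion. The constant \<open>F(1)\<close> comes from comparing two evaluations of \<open>lim n\<^sup>s E[e\<^sup>-\<^sup>n\<^sup>Y]\<close>: it is
  \<open>F(1) \<Gamma>(s + 1)\<close> by the form of \<open>f\<close> near \<open>0\<close>, and \<open>e\<^sup>-\<^sup>\<gamma>\<^sup>s\<close> because \<open>\<integral>\<^sub>0\<^sup>1 (1 - e\<^sup>-\<^sup>n\<^sup>t) / t dt - ln n\<close> tends to \<open>\<gamma>\<close>.
\<close>

lemma real_distribution_eqI_moments:
  assumes A: "real_distribution A" and B: "real_distribution B"
    and bA: "AE x in A. \<bar>x\<bar> \<le> 1" and bB: "AE x in B. \<bar>x\<bar> \<le> 1"
    and eq: "\<And>k::nat. (\<integral>x. x ^ k \<partial>A) = (\<integral>x. x ^ k \<partial>B)"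
  shows "A = B"
proof (rule Levy_uniqueness[OF A B])
  have approx: "cmod (char N t - (\<Sum>k\<le>n. ((\<i> * t) ^ k / fact k) * (\<integral>x. x ^ k \<partial>N)))
      \<le> 2 * (\<bar>t\<bar> ^ n / fact n)"
    if N: "real_distribution N" and b: "AE x in N. \<bar>x\<bar> \<le> 1" for N and t :: real and n :: nat
  proof -
    interpret N: real_distribution N by (rule N)
    have int: "integrable N (\<lambda>x. x ^ k)" for k :: nat
      by (rule N.integrable_const_bound[where B = 1])
         (use b in \<open>auto simp: power_abs power_le_one\<close>)
    have "(\<integral>x. \<bar>x\<bar> ^ n \<partial>N) \<le> 1"
    proof (rule N.integral_le_const)
      show "integrable N (\<lambda>x. \<bar>x\<bar> ^ n)"
        using integrable_abs[OF int[of n]] by (simp add: power_abs)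
      show "AE x in N. \<bar>x\<bar> ^ n \<le> 1"
        using b by eventually_elim (simp add: power_le_one)
    qed
    then have "(2 * \<bar>t\<bar> ^ n / fact n) * (\<integral>x. \<bar>x\<bar> ^ n \<partial>N) \<le> (2 * \<bar>t\<bar> ^ n / fact n) * 1"
      by (intro mult_left_mono) auto
    with N.char_approx1[of n, OF int, of t] show ?thesis
      by (simp only: mult_1_right times_divide_eq_right)
  qed
  show "char A = char B"
  proof
    fix t :: real
    define S where "S n = (\<Sum>k\<le>n. ((\<i> * t) ^ k / fact k) * (\<integral>x. x ^ k \<partial>B))" for n
    have "cmod (char A t - char B t) \<le> 4 * (\<bar>t\<bar> ^ n / fact n)" for n :: nat
      by (rule order_trans[OF norm_triangle_ineq4[of "char A t - S n" "char B t - S n", simplified]])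
         (use approx[OF A bA, of t n] approx[OF B bB, of t n] in \<open>simp add: S_def eq\<close>)
    moreover have "(\<lambda>n. 4 * (\<bar>t\<bar> ^ n / fact n)) \<longlonglongrightarrow> 4 * 0"
      using summable_LIMSEQ_zero[OF summable_exp[of "\<bar>t\<bar>"]]
      by (intro tendsto_mult tendsto_const) (simp add: divide_inverse mult.commute)
    ultimately have "cmod (char A t - char B t) \<le> 4 * 0"
      by (intro LIMSEQ_le_const[of _ "4 * 0"]) auto
    then show "char A t = char B t" by simp
  qed
qed

text \<open>The transforms at natural numbers are the moments of \<open>exp (- x)\<close>, which lies in \<open>[0,1]\<close>.\<close>

lemma real_distribution_eqI_laplace:
  assumes A: "real_distribution A" and B: "real_distribution B"
    and bA: "AE x in A. 0 \<le> x" and bB: "AE x in B. 0 \<le> x"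
    and eq: "\<And>k::nat. (\<integral>x. exp (- (real k * x)) \<partial>A) = (\<integral>x. exp (- (real k * x)) \<partial>B)"
  shows "A = B"
proof -
  interpret A: real_distribution A by (rule A)
  interpret B: real_distribution B by (rule B)
  let ?e = "\<lambda>x::real. exp (- x)"
  have "distr A borel ?e = distr B borel ?e"
  proof (rule real_distribution_eqI_moments)
    show "real_distribution (distr A borel ?e)" "real_distribution (distr B borel ?e)"
      by (auto intro!: A.real_distribution_distr B.real_distribution_distr)
    show "AE x in distr A borel ?e. \<bar>x\<bar> \<le> 1" "AE x in distr B borel ?e. \<bar>x\<bar> \<le> 1"
      using bA bB by (auto simp: AE_distr_iff)
    show "(\<integral>x. x ^ k \<partial>distr A borel ?e) = (\<integral>x. x ^ k \<partial>distr B borel ?e)" for k :: nat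
      using eq[of k] by (simp add: integral_distr exp_of_nat_mult[symmetric])
  qed
  then have "distr (distr A borel ?e) borel (\<lambda>x. - ln x) = distr (distr B borel ?e) borel (\<lambda>x. - ln x)"
    by simp
  then show ?thesis
    by (simp add: distr_distr comp_def distr_id2)
qed

text \<open>The term \<open>- 1\<close> is there because \<open>w\<close> itself need not be integrable, as for \<open>w t = 1 / t\<close> on \<open>(0,1)\<close>.\<close>

lemma laplace_has_right_derivative:
  fixes w Y :: "'a \<Rightarrow> real"
  assumes [measurable]: "w \<in> borel_measurable N" "Y \<in> borel_measurable N"
    and int: "integrable N (\<lambda>x. w x * Y x)" and pos: "AE x in N. 0 \<le> Y x" and l: "0 \<le> l"
  shows "((\<lambda>l. \<integral>x. w x * (exp (- (l * Y x)) - 1) \<partial>N) has_real_derivative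
            - (\<integral>x. w x * Y x * exp (- (l * Y x)) \<partial>N)) (at l within {l..})"
proof -
  have bnd: "\<bar>exp (- (b * y)) - exp (- (a * y))\<bar> \<le> (b - a) * y"
    if "0 \<le> a" "a \<le> b" "0 \<le> y" for a b y :: real
  proof -
    have "1 + - ((b - a) * y) \<le> exp (- ((b - a) * y))" by (rule exp_ge_add_one_self)
    moreover have "exp (- ((b - a) * y)) \<le> 1" using that by simp
    moreover have "exp (- (b * y)) = exp (- (a * y)) * exp (- ((b - a) * y))"
      by (simp add: exp_add[symmetric] algebra_simps)
    moreover have "0 < exp (- (a * y))" "exp (- (a * y)) \<le> 1" using that by auto
    ultimately have "\<bar>exp (- (b * y)) - exp (- (a * y))\<bar> = exp (- (a * y)) * (1 - exp (- ((b - a) * y)))"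
      by (simp add: algebra_simps abs_if)
    also have "\<dots> \<le> 1 * (1 - exp (- ((b - a) * y)))"
      by (rule mult_right_mono) (use \<open>exp (- (a * y)) \<le> 1\<close> \<open>exp (- ((b - a) * y)) \<le> 1\<close> in auto)
    also have "\<dots> \<le> (b - a) * y"
      using \<open>1 + - ((b - a) * y) \<le> exp (- ((b - a) * y))\<close> by simp
    finally show ?thesis .
  qed
  have intw: "integrable N (\<lambda>x. w x * (exp (- (b * Y x)) - 1))" if "0 \<le> b" for b
  proof (rule Bochner_Integration.integrable_bound)
    show "integrable N (\<lambda>x. b * (w x * Y x))" using int by simp
    show "AE x in N. norm (w x * (exp (- (b * Y x)) - 1)) \<le> norm (b * (w x * Y x))"
      using pos
    proof eventually_elim
      case (elim x)
      have "\<bar>w x\<bar> * \<bar>exp (- (b * Y x)) - 1\<bar> \<le> \<bar>w x\<bar> * (b * Y x)"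
        using bnd[of 0 b "Y x"] that elim by (intro mult_left_mono) auto
      then show ?case using elim that by (simp add: abs_mult mult_ac)
    qed
  qed auto
  show ?thesis
    unfolding has_field_derivative_iff tendsto_at_iff_sequentially comp_def
  proof (intro allI impI)
    fix X :: "nat \<Rightarrow> real"
    assume X: "\<forall>i. X i \<in> {l..} - {l}" and lim: "X \<longlonglongrightarrow> l"
    have Xl: "l < X i" for i using X by (auto simp: less_le)
    have q: "((\<integral>x. w x * (exp (- (X i * Y x)) - 1) \<partial>N) - (\<integral>x. w x * (exp (- (l * Y x)) - 1) \<partial>N)) / (X i - l)
        = (\<integral>x. w x * ((exp (- (X i * Y x)) - exp (- (l * Y x))) / (X i - l)) \<partial>N)" for i
    proof -
      have "0 \<le> X i" using Xl[of i] l by simp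
      then show ?thesis
        by (subst Bochner_Integration.integral_diff[symmetric])
           (use intw l in \<open>simp_all flip: integral_divide_zero add: right_diff_distrib\<close>)
    qed
    have "(\<lambda>i. \<integral>x. w x * ((exp (- (X i * Y x)) - exp (- (l * Y x))) / (X i - l)) \<partial>N)
        \<longlonglongrightarrow> (\<integral>x. w x * (- Y x * exp (- (l * Y x))) \<partial>N)"
    proof (rule integral_dominated_convergence[where w = "\<lambda>x. norm (w x * Y x)"])
      show "integrable N (\<lambda>x. norm (w x * Y x))" using int by simp
      show "AE x in N. (\<lambda>i. w x * ((exp (- (X i * Y x)) - exp (- (l * Y x))) / (X i - l)))
          \<longlonglongrightarrow> w x * (- Y x * exp (- (l * Y x)))"
      proof (intro AE_I2 tendsto_mult tendsto_const)
        fix x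
        have "((\<lambda>a. exp (- (a * Y x))) has_real_derivative - Y x * exp (- (l * Y x))) (at l within {l..})"
          by (auto intro!: derivative_eq_intros)
        then show "(\<lambda>i. (exp (- (X i * Y x)) - exp (- (l * Y x))) / (X i - l))
            \<longlonglongrightarrow> - Y x * exp (- (l * Y x))"
          using X lim unfolding has_field_derivative_iff tendsto_at_iff_sequentially comp_def
          by blast
      qed
      show "AE x in N. norm (w x * ((exp (- (X i * Y x)) - exp (- (l * Y x))) / (X i - l)))
          \<le> norm (w x * Y x)" for i
        using pos
      proof eventually_elim
        case (elim x)
        have "\<bar>exp (- (X i * Y x)) - exp (- (l * Y x))\<bar> / (X i - l) \<le> Y x"
          using bnd[of l "X i" "Y x"] l Xl[of i] elim by (simp add: field_simps)
        then have "\<bar>w x\<bar> * (\<bar>exp (- (X i * Y x)) - exp (- (l * Y x))\<bar> / (X i - l)) \<le> \<bar>w x\<bar> * Y x"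
          by (intro mult_left_mono) auto
        then show ?case using Xl[of i] elim by (simp add: abs_mult abs_divide)
      qed
    qed auto
    then show "(\<lambda>i. ((\<integral>x. w x * (exp (- (X i * Y x)) - 1) \<partial>N) - (\<integral>x. w x * (exp (- (l * Y x)) - 1) \<partial>N)) / (X i - l))
        \<longlonglongrightarrow> - (\<integral>x. w x * Y x * exp (- (l * Y x)) \<partial>N)"
      unfolding q by (simp add: mult.assoc)
  qed
qed

lemma exp_minus_power_bounds:
  fixes t :: real
  assumes t: "0 \<le> t" "t \<le> 1"
  shows "(1 - t) ^ n \<le> exp (- (real n * t))"
    and "exp (- (real n * t)) - (1 - t) ^ n \<le> real n * t\<^sup>2 * exp (- (real n * t))"
proof -
  have e: "exp (- (real n * t)) = exp (- t) ^ n"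
    by (simp add: exp_of_nat_mult[symmetric])
  show "(1 - t) ^ n \<le> exp (- (real n * t))"
    unfolding e using exp_ge_add_one_self[of "-t"] t by (intro power_mono) auto
  have t2: "t\<^sup>2 \<le> 1" using t by (simp add: power_le_one)
  have "1 - real n * t\<^sup>2 \<le> (1 - t\<^sup>2) ^ n"
    using Bernoulli_inequality[of "- t\<^sup>2" n] t2 by simp
  also have "\<dots> \<le> ((1 - t) * exp t) ^ n"
  proof (rule power_mono)
    have "(1 - t) * (1 + t) \<le> (1 - t) * exp t"
      using t by (intro mult_left_mono) auto
    then show "1 - t\<^sup>2 \<le> (1 - t) * exp t" by (simp add: algebra_simps power2_eq_square)
  qed (use t2 in auto)
  finally have "(1 - real n * t\<^sup>2) * exp (- t) ^ n \<le> ((1 - t) * exp t) ^ n * exp (- t) ^ n"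
    by (rule mult_right_mono) auto
  also have "\<dots> = (1 - t) ^ n"
    by (simp add: power_mult_distrib[symmetric] mult.assoc exp_add[symmetric])
  finally show "exp (- (real n * t)) - (1 - t) ^ n \<le> real n * t\<^sup>2 * exp (- (real n * t))"
    unfolding e by (simp add: algebra_simps)
qed

lemma LBINT_unit_interval_FTC:
  fixes f F :: "real \<Rightarrow> real"
  assumes "continuous_on {0..1} f"
    and "\<And>x. 0 \<le> x \<Longrightarrow> x \<le> 1 \<Longrightarrow> (F has_real_derivative f x) (at x)"
  shows "set_integrable lborel {0<..<1} f" "(LBINT x:{0<..<1}. f x) = F 1 - F 0"
proof -
  show "set_integrable lborel {0<..<1} f"
    by (rule set_integrable_subset[OF borel_integrable_atLeastAtMost'[OF assms(1)]]) auto
  have "(LBINT x=ereal 0..ereal 1. f x) = F 1 - F 0"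
  proof (rule interval_integral_FTC_finite)
    fix x :: real
    assume "min 0 1 \<le> x" "x \<le> max 0 1"
    then show "(F has_vector_derivative f x) (at x within {min 0 1..max 0 1})"
      using assms(2)[of x]
      by (simp add: has_real_derivative_iff_has_vector_derivative has_vector_derivative_at_within)
  qed (use assms in auto)
  then show "(LBINT x:{0<..<1}. f x) = F 1 - F 0"
    by (simp add: interval_lebesgue_integral_def einterval_eq)
qed

lemma LBINT_one_minus_power_eq_harm:
  "set_integrable lborel {0<..<1} (\<lambda>t::real. (1 - (1 - t) ^ n) / t)"
  "(LBINT t:{0<..<1}. (1 - (1 - t) ^ n) / t) = (harm n :: real)"
proof -
  define F :: "real \<Rightarrow> real" where "F t = (\<Sum>k<n. - ((1 - t) ^ Suc k) / real (Suc k))" for t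
  have D: "(F has_real_derivative (\<Sum>k<n. (1 - x) ^ k)) (at x)" for x
    unfolding F_def
  proof (rule DERIV_sum)
    fix k
    show "((\<lambda>t. - ((1 - t) ^ Suc k) / real (Suc k)) has_real_derivative (1 - x) ^ k) (at x)"
    proof -
      have "((\<lambda>t. - ((1 - t) ^ Suc k) / real (Suc k)) has_real_derivative
          - (real (Suc k) * (1 - x) ^ k * (0 - 1)) / real (Suc k)) (at x)"
        by (intro DERIV_cdivide DERIV_minus) (auto intro!: derivative_eq_intros simp del: power_Suc)
      then show ?thesis by (simp del: of_nat_Suc power_Suc)
    qed
  qed
  have c: "continuous_on {0..1} (\<lambda>t::real. \<Sum>k<n. (1 - t) ^ k)"
    by (intro continuous_intros)
  have eq: "(1 - (1 - t) ^ n) / t = (\<Sum>k<n. (1 - t) ^ k)" if "t \<in> {0<..<1}" for t :: real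
    using that by (simp add: sum_gp_strict)
  have "F 1 - F 0 = harm n"
    by (simp add: F_def harm_def sum_negf inverse_eq_divide sum.atLeast1_atMost_eq)
  moreover have "set_integrable lborel {0<..<1} (\<lambda>t::real. (1 - (1 - t) ^ n) / t)
      = set_integrable lborel {0<..<1} (\<lambda>t::real. \<Sum>k<n. (1 - t) ^ k)"
    by (rule set_integrable_cong) (use eq in auto)
  moreover have "(LBINT t:{0<..<1}. (1 - (1 - t) ^ n) / t) = (LBINT t:{0<..<1}. \<Sum>k<n. (1 - t :: real) ^ k)"
    by (rule set_lebesgue_integral_cong) (use eq in auto)
  ultimately show "set_integrable lborel {0<..<1} (\<lambda>t::real. (1 - (1 - t) ^ n) / t)"
    "(LBINT t:{0<..<1}. (1 - (1 - t) ^ n) / t) = (harm n :: real)"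
    using LBINT_unit_interval_FTC[OF c D] by simp_all
qed

text \<open>Replacing \<open>exp (- n t)\<close> by \<open>(1 - t)\<^sup>n\<close> costs at most \<open>1 / n\<close> and turns the integral into \<open>- harm n\<close>.\<close>

lemma LBINT_one_minus_exp_asymp:
  "(\<lambda>n. (LBINT t:{0<..<1}. (exp (- (real n * t)) - 1) / t) + ln (real n))
     \<longlonglongrightarrow> - euler_mascheroni"
proof -
  define d where "d n = (LBINT t:{0<..<1}. (exp (- (real n * t)) - (1 - t) ^ n) / t)" for n
  have main: "set_integrable lborel {0<..<1} (\<lambda>t. (exp (- (real n * t)) - (1 - t) ^ n) / t) \<and>
      0 \<le> d n \<and> d n \<le> 1 / real n" if n: "0 < n" for n
  proof -
    define F where "F t = - (t + 1 / real n) * exp (- (real n * t))" for t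
    have F: "(F has_real_derivative real n * t * exp (- (real n * t))) (at t)" for t
      unfolding F_def by (rule derivative_eq_intros refl | use n in \<open>simp add: field_simps\<close>)+
    have c: "continuous_on {0..1} (\<lambda>t. real n * t * exp (- (real n * t)))"
      by (intro continuous_intros)
    note FTC = LBINT_unit_interval_FTC[OF c F]
    have bnd: "0 \<le> (exp (- (real n * t)) - (1 - t) ^ n) / t"
        "(exp (- (real n * t)) - (1 - t) ^ n) / t \<le> real n * t * exp (- (real n * t))"
      if "t \<in> {0<..<1}" for t
      using exp_minus_power_bounds[of t n] that by (auto simp: field_simps power2_eq_square)
    have I: "set_integrable lborel {0<..<1} (\<lambda>t. (exp (- (real n * t)) - (1 - t) ^ n) / t)"
      by (rule set_integrable_bound[OF FTC(1)])
         (use bnd in \<open>auto simp: set_borel_measurable_def abs_of_nonneg simp del: abs_divide intro!: AE_I2\<close>)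
    have "d n \<le> (LBINT t:{0<..<1}. real n * t * exp (- (real n * t)))"
      unfolding d_def by (rule set_integral_mono[OF I FTC(1)]) (use bnd in auto)
    also have "\<dots> \<le> 1 / real n"
      unfolding FTC(2) using mult_nonneg_nonneg[of "1 + 1 / real n" "exp (- real n)"]
      by (simp add: F_def algebra_simps)
    finally have "d n \<le> 1 / real n" .
    moreover have "0 \<le> d n"
      unfolding d_def set_lebesgue_integral_def
      by (rule Bochner_Integration.integral_nonneg) (use bnd in \<open>auto simp: indicator_def\<close>)
    ultimately show ?thesis using I by blast
  qed
  have "d \<longlonglongrightarrow> 0"
    by (rule tendsto_sandwich[where f = "\<lambda>_. 0" and h = "\<lambda>n. 1 / real n"])
       (auto intro!: eventually_sequentiallyI[of 1] lim_1_over_n simp: main)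
  then have "(\<lambda>n. d n - (harm n - ln (real n))) \<longlonglongrightarrow> 0 - euler_mascheroni"
    by (intro tendsto_diff euler_mascheroni_LIMSEQ)
  moreover have "\<forall>\<^sub>F n in sequentially. d n - (harm n - ln (real n))
      = (LBINT t:{0<..<1}. (exp (- (real n * t)) - 1) / t) + ln (real n)"
  proof (rule eventually_sequentiallyI[of 1])
    fix n :: nat assume "1 \<le> n"
    then have "d n - harm n = (LBINT t:{0<..<1}. (exp (- (real n * t)) - (1 - t) ^ n) / t - (1 - (1 - t) ^ n) / t)"
      unfolding d_def LBINT_one_minus_power_eq_harm(2)[symmetric]
      by (intro set_integral_diff(2)[symmetric]) (use main LBINT_one_minus_power_eq_harm in auto)
    also have "\<dots> = (LBINT t:{0<..<1}. (exp (- (real n * t)) - 1) / t)"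
      by (simp add: diff_divide_distrib)
    finally show "d n - (harm n - ln (real n))
      = (LBINT t:{0<..<1}. (exp (- (real n * t)) - 1) / t) + ln (real n)" by simp
  qed
  ultimately show ?thesis by (simp add: filterlim_cong)
qed

lemma incomplete_Gamma_scaled_tendsto:
  assumes s: "0 < (s::real)"
  shows "(\<lambda>n. real n powr s * (LBINT t:{0<..1}. t powr (s - 1) * exp (- (real n * t)))) \<longlonglongrightarrow> Gamma s"
proof -
  define g where "g u = indicator {0<..} u * (u powr (s - 1) * exp (- u))" for u :: real
  have [measurable]: "g \<in> borel_measurable borel" unfolding g_def by measurable
  have G: "((\<lambda>t. t powr (s - 1) / exp t) has_integral Gamma s) {0<..}"
  proof -
    have "((\<lambda>t. if t \<in> {0<..} then t powr (s - 1) / exp t else 0) has_integral Gamma s) {0..}"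
      by (rule has_integral_spike[of "{0}", OF _ _ Gamma_integral_real[OF s]]) auto
    then show ?thesis by (subst (asm) has_integral_restrict) auto
  qed
  have hb: "has_bochner_integral lborel g (Gamma s)"
  proof (rule has_bochner_integral_nn_integral)
    show "(\<integral>\<^sup>+ u. ennreal (g u) \<partial>lborel) = ennreal (Gamma s)"
      using nn_integral_has_integral_lebesgue[OF _ G] by (simp add: g_def exp_minus field_simps)
  qed (use s in \<open>auto simp: g_def less_imp_le[OF Gamma_real_pos]\<close>)
  have eq: "real n powr s * (LBINT t:{0<..1}. t powr (s - 1) * exp (- (real n * t)))
      = (\<integral>u. indicator {..real n} u * g u \<partial>lborel)" if n: "0 < n" for n :: nat
  proof -
    have "(\<integral>u. indicator {..real n} u * g u \<partial>lborel)
        = real n * (\<integral>t. indicator {..real n} (real n * t) * g (real n * t) \<partial>lborel)"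
      using lborel_integral_real_affine[of "real n" "\<lambda>u. indicator {..real n} u * g u" 0] n by simp
    also have "(\<lambda>t. indicator {..real n} (real n * t) * g (real n * t))
        = (\<lambda>t. real n powr (s - 1) * (indicator {0<..1} t *\<^sub>R (t powr (s - 1) * exp (- (real n * t)))))"
      using n by (auto simp: g_def fun_eq_iff indicator_def powr_mult zero_less_mult_iff)
    finally have "(\<integral>u. indicator {..real n} u * g u \<partial>lborel) = (real n * real n powr (s - 1)) *
        (LBINT t:{0<..1}. t powr (s - 1) * exp (- (real n * t)))"
      unfolding set_lebesgue_integral_def integral_mult_right_zero by (simp only: mult.assoc)
    also have "real n * real n powr (s - 1) = real n powr s"
      using n by (simp add: powr_diff)
    finally show ?thesis ..
  qed
  have "(\<lambda>n. \<integral>u. indicator {..real n} u * g u \<partial>lborel) \<longlonglongrightarrow> (\<integral>u. g u \<partial>lborel)"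
  proof (rule integral_dominated_convergence[where w = g])
    show "integrable lborel g" using hb by (rule integrable.intros)
    show "AE u in lborel. (\<lambda>n. indicator {..real n} u * g u) \<longlonglongrightarrow> g u"
    proof (rule AE_I2)
      fix u :: real
      show "(\<lambda>n. indicator {..real n} u * g u) \<longlonglongrightarrow> g u"
        by (rule tendsto_eventually, rule eventually_sequentiallyI[of "nat \<lceil>u\<rceil>"])
           (auto simp: indicator_def nat_le_iff ceiling_le_iff)
    qed
    show "AE u in lborel. norm (indicator {..real n} u * g u) \<le> g u" for n
      by (auto simp: g_def indicator_def)
  qed auto
  then have "(\<lambda>n. \<integral>u. indicator {..real n} u * g u \<partial>lborel) \<longlonglongrightarrow> Gamma s"
    using hb by (simp add: has_bochner_integral_integral_eq)
  then show ?thesis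
    by (rule Lim_transform_eventually) (auto intro!: eventually_sequentiallyI[of 1] simp: eq)
qed

locale dickman_marginal = real_distribution +
  fixes s :: real
  assumes s_pos: "0 < s"
    and integrable_exp: "integrable M (\<lambda>x. exp (l * x))"
    and mgf: "(\<integral>x. exp (l * x) \<partial>M) = exp (s * (LBINT t:{0<..<1}. (exp (l * t) - 1) / t))"
begin

lemma integrable_laplace [simp]: "integrable M (\<lambda>x. exp (- (l * x)))"
  using integrable_exp[of "- l"] by simp

lemma laplace: "(\<integral>x. exp (- (l * x)) \<partial>M) = exp (s * (LBINT t:{0<..<1}. (exp (- (l * t)) - 1) / t))"
  using mgf[of "- l"] by simp

lemma laplace_le_1:
  assumes "0 \<le> l" shows "(\<integral>x. exp (- (l * x)) \<partial>M) \<le> 1"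
proof -
  have "0 \<le> (LBINT t:{0<..<1}. - ((exp (- (l * t)) - 1) / t))"
    unfolding set_lebesgue_integral_def
    by (rule Bochner_Integration.integral_nonneg)
       (use assms in \<open>auto simp: indicator_def divide_nonpos_pos\<close>)
  then have "(LBINT t:{0<..<1}. (exp (- (l * t)) - 1) / t) \<le> 0"
    by (simp add: set_lebesgue_integral_def)
  then show ?thesis
    unfolding laplace using s_pos by (simp add: mult_nonneg_nonpos)
qed

lemma AE_nonneg: "AE x in M. 0 \<le> x"
proof -
  have "AE x in M. - (1 / real (Suc m)) < x" for m
  proof -
    define e where "e = 1 / real (Suc m)"
    have e: "0 < e" by (simp add: e_def)
    have "prob {.. - e} \<le> exp (- e) ^ n" for n
    proof -
      have "(\<integral>x. indicator {.. - e} x * exp (real n * e) \<partial>M) \<le> (\<integral>x. exp (- (real n * x)) \<partial>M)"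
      proof (rule integral_mono)
        show "indicator {.. - e} x * exp (real n * e) \<le> exp (- (real n * x))" for x
          using mult_left_mono[of e "- x" "real n"] by (auto simp: indicator_def)
      qed (auto intro!: integrable_mult_left integrable_real_indicator simp: emeasure_eq_measure)
      also have "\<dots> \<le> 1" by (rule laplace_le_1) simp
      finally have "prob {.. - e} * exp (real n * e) \<le> 1" by simp
      then have "prob {.. - e} \<le> exp (- (real n * e))"
        by (simp add: exp_minus field_simps)
      then show ?thesis by (simp add: exp_of_nat_mult[symmetric])
    qed
    moreover have "(\<lambda>n. exp (- e) ^ n) \<longlonglongrightarrow> 0"
      using e by (intro LIMSEQ_power_zero) simp
    ultimately have "prob {.. - e} \<le> 0"
      by (intro LIMSEQ_le_const[of _ 0]) auto
    then have "prob {.. - e} = 0" by (simp add: measure_le_0_iff)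
    then have "AE x in M. x \<notin> {.. - e}"
      by (subst (asm) prob_eq_0) auto
    then show ?thesis by eventually_elim (auto simp: e_def)
  qed
  then have "AE x in M. \<forall>m. - (1 / real (Suc m)) < x" by (simp add: AE_all_countable)
  then show ?thesis
  proof eventually_elim
    case (elim x)
    show ?case
    proof (rule ccontr)
      assume "\<not> 0 \<le> x"
      then obtain m where "1 / real (Suc m) < - x"
        using nat_approx_posE[of "- x"] by auto
      with elim[rule_format, of m] show False by simp
    qed
  qed
qed

lemma laplace_asymp:
  "(\<lambda>n. real n powr s * (\<integral>x. exp (- (real n * x)) \<partial>M)) \<longlonglongrightarrow> exp (- euler_mascheroni * s)"
proof -
  have "(\<lambda>n. exp (s * ((LBINT t:{0<..<1}. (exp (- (real n * t)) - 1) / t) + ln (real n))))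
      \<longlonglongrightarrow> exp (s * - euler_mascheroni)"
    by (intro tendsto_intros LBINT_one_minus_exp_asymp)
  moreover have "\<forall>\<^sub>F n in sequentially.
      exp (s * ((LBINT t:{0<..<1}. (exp (- (real n * t)) - 1) / t) + ln (real n)))
      = real n powr s * (\<integral>x. exp (- (real n * x)) \<partial>M)"
    by (rule eventually_sequentiallyI[of 1])
       (simp add: laplace powr_def exp_add[symmetric] distrib_left)
  ultimately show ?thesis
    by (simp add: Lim_transform_eventually mult.commute)
qed

lemma prob_nonpos: "prob {..0} = 0"
proof -
  have "prob {..0} \<le> (\<integral>x. exp (- (real n * x)) \<partial>M)" for n
  proof -
    have "(\<integral>x. indicator {..0} x \<partial>M) \<le> (\<integral>x. exp (- (real n * x)) \<partial>M)"
    proof (rule integral_mono)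
      show "integrable M (indicat_real {..0})"
        by (auto intro!: integrable_real_indicator simp: emeasure_eq_measure)
    qed (auto simp: indicator_def mult_nonneg_nonpos)
    then show ?thesis by simp
  qed
  moreover have "(\<lambda>n. \<integral>x. exp (- (real n * x)) \<partial>M) \<longlonglongrightarrow> 0"
  proof -
    have "(\<lambda>n. real n powr - s) \<longlonglongrightarrow> 0"
      using s_pos by (intro tendsto_neg_powr filterlim_real_sequentially) auto
    from tendsto_mult[OF this laplace_asymp]
    have "(\<lambda>n. real n powr - s * (real n powr s * (\<integral>x. exp (- (real n * x)) \<partial>M))) \<longlonglongrightarrow> 0"
      by simp
    then show ?thesis
      by (rule Lim_transform_eventually)
         (auto intro!: eventually_sequentiallyI[of 1] simp: powr_minus)
  qed
  ultimately have "prob {..0} \<le> 0"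
    by (intro LIMSEQ_le_const[of _ 0]) auto
  then show ?thesis by (simp add: measure_le_0_iff)
qed

lemma AE_pos: "AE x in M. 0 < x"
proof -
  have "AE x in M. x \<notin> {..0}"
    using prob_nonpos by (subst (asm) prob_eq_0) auto
  then show ?thesis by eventually_elim auto
qed

lemma integrable_id: "integrable M (\<lambda>x. x)"
proof (rule Bochner_Integration.integrable_bound)
  show "integrable M (\<lambda>x. exp (1 * x))" by (rule integrable_exp)
  show "AE x in M. norm x \<le> norm (exp (1 * x))"
    using AE_nonneg
  proof eventually_elim
    case (elim x)
    have "x \<le> exp x" using exp_ge_add_one_self[of x] by linarith
    with elim show ?case by simp
  qed
qed simp

lemma laplace_size_biased:
  assumes l: "0 \<le> l"
  shows "(\<integral>x. x * exp (- (l * x)) \<partial>M)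
    = s * (LBINT t:{0<..<1}. exp (- (l * t))) * (\<integral>x. exp (- (l * x)) \<partial>M)"
proof -
  let ?L = "\<lambda>l. \<integral>x. exp (- (l * x)) \<partial>M"
  let ?G = "\<lambda>l. LBINT t:{0<..<1}. (exp (- (l * t)) - 1) / t"
  have "((\<lambda>l. \<integral>x. 1 * (exp (- (l * x)) - 1) \<partial>M) has_real_derivative
      - (\<integral>x. 1 * x * exp (- (l * x)) \<partial>M)) (at l within {l..})"
    by (rule laplace_has_right_derivative[OF _ _ _ AE_nonneg l]) (simp_all add: integrable_id)
  then have "((\<lambda>l. ?L l - 1) has_real_derivative - (\<integral>x. x * exp (- (l * x)) \<partial>M)) (at l within {l..})"
    using prob_space by simp
  from DERIV_add[OF this DERIV_const[of 1]] have 1: "(?L has_real_derivative - (\<integral>x. x * exp (- (l * x)) \<partial>M)) (at l within {l..})"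
    by simp
  have "((\<lambda>l. \<integral>t. (indicator {0<..<1::real} t / t) * (exp (- (l * max 0 t)) - 1) \<partial>lborel) has_real_derivative
      - (\<integral>t. (indicator {0<..<1::real} t / t) * max 0 t * exp (- (l * max 0 t)) \<partial>lborel)) (at l within {l..})"
  proof (rule laplace_has_right_derivative)
    have "(\<lambda>t. (indicator {0<..<1} t / t) * max 0 t) = (indicator {0<..<1} :: real \<Rightarrow> real)"
      by (auto simp: fun_eq_iff indicator_def)
    then show "integrable lborel (\<lambda>t. (indicator {0<..<1} t / t) * max 0 t :: real)"
      by simp
  qed (use l in auto)
  moreover have "(\<lambda>l. \<integral>t. (indicator {0<..<1::real} t / t) * (exp (- (l * max 0 t)) - 1) \<partial>lborel) = ?G"
    by (auto simp: set_lebesgue_integral_def fun_eq_iff indicator_def intro!: Bochner_Integration.integral_cong)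
  moreover have "(\<integral>t. (indicator {0<..<1::real} t / t) * max 0 t * exp (- (l * max 0 t)) \<partial>lborel)
      = (LBINT t:{0<..<1}. exp (- (l * t)))"
    by (auto simp: set_lebesgue_integral_def indicator_def intro!: Bochner_Integration.integral_cong)
  ultimately have "(?G has_real_derivative - (LBINT t:{0<..<1}. exp (- (l * t)))) (at l within {l..})"
    by simp
  then have "((\<lambda>l. exp (s * ?G l)) has_real_derivative
      exp (s * ?G l) * (s * - (LBINT t:{0<..<1}. exp (- (l * t))))) (at l within {l..})"
    by (auto intro!: derivative_eq_intros)
  then have 2: "(?L has_real_derivative
      - (s * (LBINT t:{0<..<1}. exp (- (l * t))) * ?L l)) (at l within {l..})"
    unfolding laplace by (simp add: mult.commute)
  have "at l within {l..} \<noteq> bot"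
    using trivial_limit_at_right_real[of l] by (simp add: at_within_Ici_at_right)
  then have "- (\<integral>x. x * exp (- (l * x)) \<partial>M) = - (s * (LBINT t:{0<..<1}. exp (- (l * t))) * ?L l)"
    using 1 2 unfolding has_field_derivative_iff by (rule tendsto_unique)
  then show ?thesis by simp
qed

lemma measurable_window [measurable]:
  "(\<lambda>t. emeasure M {t - 1<..<t}) \<in> borel_measurable borel"
proof -
  have eq: "emeasure M {t - 1<..<t} = (\<integral>\<^sup>+x. indicator {p. fst p - 1 < snd p \<and> snd p < fst p} (t, x) \<partial>M)" for t
  proof -
    have "emeasure M {t - 1<..<t} = (\<integral>\<^sup>+x. indicator {t - 1<..<t} x \<partial>M)" by simp
    also have "\<dots> = (\<integral>\<^sup>+x. indicator {p. fst p - 1 < snd p \<and> snd p < fst p} (t, x) \<partial>M)"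
      by (rule nn_integral_cong) (auto simp: indicator_def)
    finally show ?thesis .
  qed
  show ?thesis unfolding eq by measurable
qed

lemma nn_integral_window_exp:
  "(\<integral>\<^sup>+t. emeasure M {t - 1<..<t} * ennreal (exp (- (l * t))) \<partial>lborel)
    = ennreal ((LBINT t:{0<..<1}. exp (- (l * t))) * (\<integral>x. exp (- (l * x)) \<partial>M))"
proof -
  interpret pair_sigma_finite M lborel ..
  define c where "c = (LBINT t:{0<..<1}. exp (- (l * t)))"
  have "set_integrable lborel {0<..<1} (\<lambda>t. exp (- (l * t)))"
    by (rule set_integrable_subset[OF borel_integrable_atLeastAtMost'[of 0 1]])
       (auto intro!: continuous_intros)
  then have c: "(\<integral>\<^sup>+u. ennreal (indicator {0<..<1} u * exp (- (l * u))) \<partial>lborel) = ennreal c" "0 \<le> c"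
    unfolding c_def set_lebesgue_integral_def set_integrable_def
    by (auto intro!: nn_integral_eq_integral Bochner_Integration.integral_nonneg)
  have "(\<integral>\<^sup>+t. emeasure M {t - 1<..<t} * ennreal (exp (- (l * t))) \<partial>lborel)
      = (\<integral>\<^sup>+t. (\<integral>\<^sup>+x. ennreal (indicator {0<..<1} (t - x) * exp (- (l * t))) \<partial>M) \<partial>lborel)"
  proof (rule nn_integral_cong)
    fix t :: real
    have "emeasure M {t - 1<..<t} * ennreal (exp (- (l * t)))
        = (\<integral>\<^sup>+x. indicator {t - 1<..<t} x * ennreal (exp (- (l * t))) \<partial>M)"
      by (subst nn_integral_multc) auto
    also have "\<dots> = (\<integral>\<^sup>+x. ennreal (indicator {0<..<1} (t - x) * exp (- (l * t))) \<partial>M)"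
      by (rule nn_integral_cong) (auto simp: indicator_def)
    finally show "emeasure M {t - 1<..<t} * ennreal (exp (- (l * t)))
        = (\<integral>\<^sup>+x. ennreal (indicator {0<..<1} (t - x) * exp (- (l * t))) \<partial>M)" .
  qed
  also have "\<dots> = (\<integral>\<^sup>+x. (\<integral>\<^sup>+t. ennreal (indicator {0<..<1} (t - x) * exp (- (l * t))) \<partial>lborel) \<partial>M)"
    by (rule Fubini') measurable
  also have "\<dots> = (\<integral>\<^sup>+x. ennreal (exp (- (l * x))) * ennreal c \<partial>M)"
  proof (rule nn_integral_cong)
    fix x :: real
    have "(\<integral>\<^sup>+t. ennreal (indicator {0<..<1} (t - x) * exp (- (l * t))) \<partial>lborel)
        = (\<integral>\<^sup>+u. ennreal (indicator {0<..<1} u * exp (- (l * (x + u)))) \<partial>lborel)"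
      by (subst nn_integral_real_affine[where c = 1 and t = x]) auto
    also have "\<dots> = (\<integral>\<^sup>+u. ennreal (exp (- (l * x))) * ennreal (indicator {0<..<1} u * exp (- (l * u))) \<partial>lborel)"
      by (rule nn_integral_cong)
         (simp add: ennreal_mult[symmetric] exp_add[symmetric] algebra_simps)
    also have "\<dots> = ennreal (exp (- (l * x))) * ennreal c"
      by (subst nn_integral_cmult) (auto simp: c)
    finally show "(\<integral>\<^sup>+t. ennreal (indicator {0<..<1} (t - x) * exp (- (l * t))) \<partial>lborel)
      = ennreal (exp (- (l * x))) * ennreal c" .
  qed
  also have "\<dots> = ennreal (\<integral>x. exp (- (l * x)) \<partial>M) * ennreal c"
    by (subst nn_integral_multc) (auto simp: nn_integral_eq_integral)
  also have "\<dots> = ennreal (c * (\<integral>x. exp (- (l * x)) \<partial>M))"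
    using c(2) by (simp add: ennreal_mult mult.commute)
  finally show ?thesis unfolding c_def .
qed

lemma density_size_biased:
  "density M (\<lambda>x. ennreal (x / s)) = density lborel (\<lambda>t. emeasure M {t - 1<..<t})"
    (is "?A = ?B")
proof -
  let ?c = "\<lambda>k. (LBINT t:{0<..<1}. exp (- (k * t))) * (\<integral>x. exp (- (k * x)) \<partial>M)"
  have A: "(\<integral>\<^sup>+x. ennreal (exp (- (k * x))) \<partial>?A) = ennreal (?c k)" if k: "0 \<le> k" for k
  proof -
    have "(\<integral>\<^sup>+x. ennreal (exp (- (k * x))) \<partial>?A) = (\<integral>\<^sup>+x. ennreal (x * exp (- (k * x)) / s) \<partial>M)"
      using AE_nonneg
      by (subst nn_integral_density)
         (auto intro!: nn_integral_cong_AE simp: ennreal_mult[symmetric] s_pos less_imp_le elim!: eventually_mono)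
    also have "\<dots> = ennreal (\<integral>x. x * exp (- (k * x)) / s \<partial>M)"
    proof (rule nn_integral_eq_integral)
      show "integrable M (\<lambda>x. x * exp (- (k * x)) / s)"
      proof (rule Bochner_Integration.integrable_bound)
        show "integrable M (\<lambda>x. x / s)" using integrable_id by simp
        show "AE x in M. norm (x * exp (- (k * x)) / s) \<le> norm (x / s)"
          using AE_nonneg
        proof eventually_elim
          case (elim x)
          then have "x * exp (- (k * x)) \<le> x * 1" using k by (intro mult_left_mono) auto
          with elim s_pos show ?case by (simp add: divide_right_mono)
        qed
      qed simp
      show "AE x in M. 0 \<le> x * exp (- (k * x)) / s"
        using AE_nonneg by eventually_elim (use s_pos in simp)
    qed
    also have "(\<integral>x. x * exp (- (k * x)) / s \<partial>M) = ?c k"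
      using laplace_size_biased[OF k] s_pos by simp
    finally show ?thesis .
  qed
  have B: "(\<integral>\<^sup>+x. ennreal (exp (- (k * x))) \<partial>?B) = ennreal (?c k)" for k
    by (subst nn_integral_density) (auto simp: nn_integral_window_exp)
  have c0: "?c 0 = 1"
    using prob_space by (simp add: set_lebesgue_integral_def)
  have emA: "emeasure ?A (space ?A) = 1"
    using A[of 0] c0 by (simp add: nn_integral_const)
  have emB: "emeasure ?B (space ?B) = 1"
    using B[of 0] c0 by simp
  show ?thesis
  proof (rule real_distribution_eqI_laplace)
    show "real_distribution ?A" "real_distribution ?B"
      by (auto simp: real_distribution_def real_distribution_axioms_def intro!: prob_spaceI emA emB)
    show "AE x in ?A. 0 \<le> x"
      using AE_nonneg by (subst AE_density) auto
    show "AE x in ?B. 0 \<le> x"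
    proof -
      have "0 \<le> t" if "0 < emeasure M {t - 1<..<t}" for t
      proof (rule ccontr)
        assume "\<not> 0 \<le> t"
        then have "emeasure M {t - 1<..<t} \<le> emeasure M {..0}"
          by (intro emeasure_mono) auto
        with that prob_nonpos show False by (simp add: emeasure_eq_measure)
      qed
      then show ?thesis by (subst AE_density) (auto intro!: AE_I2)
    qed
    show "(\<integral>x. exp (- (real k * x)) \<partial>?A) = (\<integral>x. exp (- (real k * x)) \<partial>?B)" for k
      by (simp add: integral_eq_nn_integral A B)
  qed
qed

definition dens :: "real \<Rightarrow> real" where
  "dens t = (if 0 < t then s / t * prob {t - 1<..<t} else 0)"

lemma dens_nonneg: "0 \<le> dens t"
  using s_pos by (simp add: dens_def)

lemma measurable_dens [measurable]: "dens \<in> borel_measurable borel"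
proof -
  have "(\<lambda>t. enn2real (emeasure M {t - 1<..<t})) \<in> borel_measurable borel"
    by measurable
  then have [measurable]: "(\<lambda>t. prob {t - 1<..<t}) \<in> borel_measurable borel"
    by (simp add: measure_def)
  show ?thesis unfolding dens_def[abs_def] by measurable
qed

lemma eq_density_dens: "M = density lborel (\<lambda>t. ennreal (dens t))"
proof -
  define h :: "real \<Rightarrow> ennreal" where "h x = indicator {0<..} x * ennreal (s / x)" for x
  have [measurable]: "h \<in> borel_measurable borel" unfolding h_def by measurable
  have "density M (\<lambda>x. 1) = density M (\<lambda>x. ennreal (x / s) * h x)"
  proof (rule density_cong)
    show "AE x in M. 1 = ennreal (x / s) * h x"
      using AE_pos by eventually_elim
        (use s_pos in \<open>simp add: h_def ennreal_mult[symmetric]\<close>)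
  qed auto
  also have "\<dots> = density (density M (\<lambda>x. ennreal (x / s))) h"
    by (rule density_density_eq[symmetric]) auto
  also have "\<dots> = density (density lborel (\<lambda>t. emeasure M {t - 1<..<t})) h"
    by (simp only: density_size_biased)
  also have "\<dots> = density lborel (\<lambda>t. emeasure M {t - 1<..<t} * h t)"
    by (rule density_density_eq) auto
  also have "(\<lambda>t. emeasure M {t - 1<..<t} * h t) = (\<lambda>t. ennreal (dens t))"
    using s_pos
    by (auto simp: fun_eq_iff h_def dens_def emeasure_eq_measure indicator_def ennreal_mult[symmetric] mult.commute)
  finally show ?thesis by (simp add: density_1)
qed

lemma emeasure_eq_dens:
  "A \<in> sets borel \<Longrightarrow> emeasure M A = (\<integral>\<^sup>+t. ennreal (dens t) * indicator A t \<partial>lborel)"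
  by (subst eq_density_dens) (simp add: emeasure_density)

lemma prob_singleton: "prob {x} = 0"
proof -
  have "emeasure M {x} = 0"
    unfolding emeasure_eq_dens[OF borel_singleton[OF sets.empty_sets]]
    by (subst nn_integral_0_iff_AE) (auto intro!: AE_I'[of "{x}"])
  then show ?thesis by (simp add: measure_def)
qed

lemma isCont_cdf_everywhere: "isCont (cdf M) x"
  by (simp add: isCont_cdf prob_singleton)

lemma cdf_nonpos: "t \<le> 0 \<Longrightarrow> cdf M t = 0"
  using prob_nonpos cdf_nondecreasing[of t 0] cdf_nonneg[of t] by (simp add: cdf_def measure_le_0_iff)

lemma dens_eq_cdf:
  assumes "0 < t" shows "dens t = s / t * (cdf M t - cdf M (t - 1))"
proof -
  have "cdf M t - cdf M (t - 1) = prob {t - 1<..t}"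
    by (rule cdf_diff_eq) simp
  also have "{t - 1<..t} = {t - 1<..<t} \<union> {t}" by auto
  also have "prob \<dots> = prob {t - 1<..<t}"
    by (subst finite_measure_Union) (auto simp: prob_singleton)
  finally show ?thesis using assms by (simp add: dens_def)
qed

lemma continuous_on_dens: "continuous_on {0<..} dens"
proof -
  have c: "continuous_on A (cdf M)" for A
    by (intro continuous_at_imp_continuous_on ballI isCont_cdf_everywhere)
  have "continuous_on {0<..} (\<lambda>t. s / t * (cdf M t - cdf M (t - 1)))"
    by (intro continuous_intros continuous_on_compose2[OF c[of UNIV]]) auto
  then show ?thesis
    by (rule continuous_on_eq) (simp add: dens_eq_cdf)
qed

lemma cdf_has_derivative:
  assumes t: "0 < t" shows "(cdf M has_real_derivative dens t) (at t)"
proof -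
  define a where "a = t / 2"
  define b where "b = t + 1"
  have ab: "0 < a" "a < t" "t < b" using t by (auto simp: a_def b_def)
  have c: "continuous_on {a..b} dens"
    by (rule continuous_on_subset[OF continuous_on_dens]) (use ab in auto)
  have eq: "integral {a..u} dens + cdf M a = cdf M u" if u: "u \<in> {a..b}" for u
  proof -
    have "continuous_on {a..u} dens" by (rule continuous_on_subset[OF c]) (use u in auto)
    then have I: "(dens has_integral integral {a..u} dens) {a..u}"
      by (intro integrable_integral integrable_continuous_real)
    then have nn: "0 \<le> integral {a..u} dens"
      by (rule has_integral_nonneg) (rule dens_nonneg)
    have "emeasure M {a..u} = ennreal (integral {a..u} dens)"
      using nn_integral_has_integral_lebesgue'[OF dens_nonneg I] by (simp add: emeasure_eq_dens)
    with nn have "prob {a..u} = integral {a..u} dens" by (simp add: measure_def)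
    moreover have "cdf M u = cdf M a + prob {a..u}"
    proof -
      have "{..u} = {..<a} \<union> {a..u}" using u by auto
      then have "prob {..u} = prob {..<a} + prob {a..u}"
        by (simp only:) (rule finite_measure_Union, auto)
      moreover have "{..a} = {..<a} \<union> {a}" by auto
      then have "prob {..a} = prob {..<a} + prob {a}"
        by (simp only:) (rule finite_measure_Union, auto)
      ultimately show ?thesis by (simp add: cdf_def prob_singleton)
    qed
    ultimately show ?thesis by simp
  qed
  have "((\<lambda>u. integral {a..u} dens + cdf M a) has_real_derivative dens t) (at t within {a..b})"
    using integral_has_real_derivative[OF c, of t] ab by (auto intro!: derivative_eq_intros)
  then have "(cdf M has_real_derivative dens t) (at t within {a..b})"
    by (rule has_field_derivative_transform_within[OF _ zero_less_one]) (use ab eq in auto)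
  then show ?thesis
    using ab at_within_Icc_at[of a t b] by simp
qed

lemma cdf_eq_powr:
  assumes t: "0 < t" "t \<le> 1" shows "cdf M t = cdf M 1 * t powr s"
proof (cases "t = 1")
  case False
  define h where "h u = cdf M u * u powr - s" for u
  have "h 1 = h t"
  proof (rule DERIV_isconst2[of t 1])
    show "continuous_on {t..1} h"
      unfolding h_def using t
      by (intro continuous_intros continuous_at_imp_continuous_on ballI isCont_cdf_everywhere) auto
    fix u assume u: "t < u" "u < 1"
    have "(h has_real_derivative dens u * u powr - s + cdf M u * (- s * u powr (- s - 1))) (at u)"
      unfolding h_def
      using cdf_has_derivative[of u] has_real_derivative_powr[of u "- s"] u t
      by (auto intro!: derivative_eq_intros)
    moreover have "dens u * u powr - s + cdf M u * (- s * u powr (- s - 1)) = 0"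
      using u t by (simp add: dens_eq_cdf cdf_nonpos powr_diff field_simps)
    ultimately show "(h has_real_derivative 0) (at u)" by simp
  qed (use t False in auto)
  then show ?thesis using t by (simp add: h_def powr_minus field_simps)
qed simp

lemma dens_eq_powr:
  assumes t: "0 < t" "t \<le> 1" shows "dens t = cdf M 1 * (s * t powr (s - 1))"
  using t by (simp add: dens_eq_cdf cdf_nonpos cdf_eq_powr[of t] powr_diff)

lemma cdf_1: "cdf M 1 = exp (- euler_mascheroni * s) / Gamma (s + 1)"
proof -
  let ?P = "\<lambda>n. LBINT t:{0<..1}. t powr (s - 1) * exp (- (real n * t))"
  define r where "r n = (\<integral>x. indicator {1<..} x * exp (- (real n * x)) \<partial>M)" for n
  have int: "integrable M (\<lambda>x. indicator A x * exp (- (real n * x)))" if "A \<in> sets borel" for A n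
    by (rule Bochner_Integration.integrable_bound[OF integrable_laplace[of "real n"]])
       (use that in \<open>auto simp: indicator_def\<close>)
  have split: "(\<integral>x. exp (- (real n * x)) \<partial>M) = cdf M 1 * s * ?P n + r n" for n
  proof -
    have "(\<integral>x. exp (- (real n * x)) \<partial>M)
        = (\<integral>x. indicator {..1} x * exp (- (real n * x)) + indicator {1<..} x * exp (- (real n * x)) \<partial>M)"
      by (rule Bochner_Integration.integral_cong) (auto simp: indicator_def)
    also have "\<dots> = (\<integral>x. indicator {..1} x * exp (- (real n * x)) \<partial>M) + r n"
      unfolding r_def by (rule Bochner_Integration.integral_add) (auto intro!: int)
    also have "(\<integral>x. indicator {..1} x * exp (- (real n * x)) \<partial>M)
        = (\<integral>x. dens x * (indicator {..1} x * exp (- (real n * x))) \<partial>lborel)"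
      by (subst eq_density_dens, subst integral_real_density) (auto simp: dens_nonneg)
    also have "\<dots> = (\<integral>t. (cdf M 1 * s) * (indicator {0<..1} t *\<^sub>R (t powr (s - 1) * exp (- (real n * t)))) \<partial>lborel)"
    proof (rule Bochner_Integration.integral_cong)
      fix t :: real
      show "dens t * (indicator {..1} t * exp (- (real n * t)))
        = (cdf M 1 * s) * (indicator {0<..1} t *\<^sub>R (t powr (s - 1) * exp (- (real n * t))))"
      proof (cases "0 < t")
        case True
        then show ?thesis using dens_eq_powr[of t] by (auto simp: indicator_def)
      qed (auto simp: dens_def indicator_def)
    qed simp
    also have "\<dots> = cdf M 1 * s * ?P n"
      unfolding set_lebesgue_integral_def by (rule integral_mult_right_zero)
    finally show ?thesis .
  qed
  have r: "0 \<le> r n" "r n \<le> exp (- real n)" for n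
  proof -
    show "0 \<le> r n" unfolding r_def by (rule Bochner_Integration.integral_nonneg) auto
    show "r n \<le> exp (- real n)"
      unfolding r_def
    proof (rule integral_le_const[OF int])
      show "AE x in M. indicator {1<..} x * exp (- (real n * x)) \<le> exp (- real n)"
        using mult_left_mono[of 1 _ "real n"] by (auto simp: indicator_def)
    qed simp
  qed
  define k where "k = nat \<lceil>s\<rceil>"
  have "(\<lambda>n. real n ^ k / exp (real n)) \<longlonglongrightarrow> 0"
    by (rule filterlim_compose[OF tendsto_power_div_exp_0 filterlim_real_sequentially])
  then have "(\<lambda>n. real n powr s * r n) \<longlonglongrightarrow> 0"
  proof (rule tendsto_sandwich[rotated 3])
    show "\<forall>\<^sub>F n in sequentially. real n powr s * r n \<le> real n ^ k / exp (real n)"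
    proof (rule eventually_sequentiallyI[of 1])
      fix n :: nat assume n: "1 \<le> n"
      have "s \<le> real k" unfolding k_def by linarith
      with n have "real n powr s \<le> real n ^ k"
        using powr_mono[of s "real k" "real n"] by (simp add: powr_realpow)
      then have "real n powr s * r n \<le> real n ^ k * exp (- real n)"
        by (intro mult_mono r) auto
      then show "real n powr s * r n \<le> real n ^ k / exp (real n)"
        by (simp add: exp_minus field_simps)
    qed
    show "\<forall>\<^sub>F n in sequentially. 0 \<le> real n powr s * r n"
      by (intro always_eventually allI mult_nonneg_nonneg r) simp
  qed simp
  then have "(\<lambda>n. cdf M 1 * s * (real n powr s * ?P n) + real n powr s * r n)
      \<longlonglongrightarrow> cdf M 1 * s * Gamma s + 0"
    by (intro tendsto_intros incomplete_Gamma_scaled_tendsto s_pos)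
  moreover have "real n powr s * (\<integral>x. exp (- (real n * x)) \<partial>M)
      = cdf M 1 * s * (real n powr s * ?P n) + real n powr s * r n" for n
    unfolding split distrib_left by (simp only: mult.left_commute mult.assoc)
  ultimately have "(\<lambda>n. real n powr s * (\<integral>x. exp (- (real n * x)) \<partial>M)) \<longlonglongrightarrow> cdf M 1 * (s * Gamma s)"
    by (simp add: mult.assoc)
  from LIMSEQ_unique[OF this laplace_asymp]
  have "cdf M 1 * Gamma (s + 1) = exp (- euler_mascheroni * s)"
    using s_pos Gamma_plus1[of s] by (auto simp: nonpos_Ints_def)
  moreover have "Gamma (s + 1) \<noteq> 0"
    using s_pos Gamma_real_pos[of "s + 1"] by linarith
  ultimately show ?thesis by (simp add: eq_divide_eq)
qed

lemma dens_recursion: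
  assumes t: "1 < t"
  shows "dens t = s * t powr (s - 1) * (cdf M 1 - (LBINT a:{0..t - 1}. dens a / (1 + a) powr s))"
proof -
  define h where "h a = (cdf M (1 + a) - cdf M a) * (1 + a) powr - s" for a
  have "((\<lambda>a. - (dens a / (1 + a) powr s)) has_integral h (t - 1) - h 0) {0..t - 1}"
  proof (rule fundamental_theorem_of_calculus_interior)
    have c: "continuous_on A (cdf M)" for A
      by (intro continuous_at_imp_continuous_on ballI isCont_cdf_everywhere)
    show "continuous_on {0..t - 1} h"
      unfolding h_def by (intro continuous_intros continuous_on_compose2[OF c[of UNIV]]) auto
    fix a assume a: "a \<in> {0<..<t - 1}"
    have "((\<lambda>a. cdf M (1 + a)) has_real_derivative dens (1 + a)) (at a)"
      using cdf_has_derivative[of "1 + a"] a DERIV_shift[of "cdf M" "dens (1 + a)" a 1]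
      by (simp add: add.commute)
    moreover have "((\<lambda>a. (1 + a) powr - s) has_real_derivative - s * (1 + a) powr (- s - 1)) (at a)"
      using a by (auto intro!: derivative_eq_intros)
    ultimately have "(h has_real_derivative (dens (1 + a) - dens a) * (1 + a) powr - s
        + (cdf M (1 + a) - cdf M a) * (- s * (1 + a) powr (- s - 1))) (at a)"
      unfolding h_def using cdf_has_derivative[of a] a by (auto intro!: derivative_eq_intros)
    moreover have "(dens (1 + a) - dens a) * (1 + a) powr - s
        + (cdf M (1 + a) - cdf M a) * (- s * (1 + a) powr (- s - 1)) = - (dens a / (1 + a) powr s)"
    proof -
      define p where "p = (1 + a) powr - s"
      have p: "(1 + a) powr (- s - 1) = p / (1 + a)" "dens a / (1 + a) powr s = dens a * p"
        using a by (simp_all add: p_def powr_diff powr_minus divide_inverse)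
      have d: "dens (1 + a) = s / (1 + a) * (cdf M (1 + a) - cdf M a)"
        using a dens_eq_cdf[of "1 + a"] by simp
      show ?thesis
        unfolding p d p_def[symmetric] by (simp add: algebra_simps)
    qed
    ultimately show "(h has_vector_derivative - (dens a / (1 + a) powr s)) (at a)"
      by (simp add: has_real_derivative_iff_has_vector_derivative)
  qed (use t in simp)
  from has_integral_neg[OF this]
  have I: "((\<lambda>a. dens a / (1 + a) powr s) has_integral h 0 - h (t - 1)) {0..t - 1}"
    by simp
  have "integrable lborel dens"
  proof (rule integrableI_nonneg)
    show "(\<integral>\<^sup>+ x. ennreal (dens x) \<partial>lborel) < \<infinity>"
      using emeasure_eq_dens[of UNIV] emeasure_space_1 by simp
  qed (auto simp: dens_nonneg)
  then have "set_integrable lborel {0..t - 1} (\<lambda>a. dens a / (1 + a) powr s)"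
    unfolding set_integrable_def
  proof (rule Bochner_Integration.integrable_bound)
    show "AE a in lborel. norm (indicator {0..t - 1} a *\<^sub>R (dens a / (1 + a) powr s)) \<le> norm (dens a)"
    proof (rule AE_I2)
      fix a :: real
      have "dens a / (1 + a) powr s \<le> dens a / 1" if "0 \<le> a"
        using that s_pos ge_one_powr_ge_zero[of "1 + a" s]
        by (intro divide_left_mono) (auto simp: dens_nonneg)
      then show "norm (indicator {0..t - 1} a *\<^sub>R (dens a / (1 + a) powr s)) \<le> norm (dens a)"
        by (auto simp: indicator_def dens_nonneg)
    qed
  qed auto
  then have "(LBINT a:{0..t - 1}. dens a / (1 + a) powr s) = h 0 - h (t - 1)"
    using I by (simp add: set_borel_integral_eq_integral(2) integral_unique)
  moreover have "h 0 = cdf M 1" by (simp add: h_def cdf_nonpos)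
  moreover have "dens t = s * t powr (s - 1) * h (t - 1)"
  proof -
    have "t powr (s - 1) * t powr - s = 1 / t"
      using t by (simp add: powr_diff powr_minus_divide)
    moreover have "s * t powr (s - 1) * h (t - 1)
        = s * (t powr (s - 1) * t powr - s) * (cdf M t - cdf M (t - 1))"
      by (simp add: h_def)
    ultimately show ?thesis using t by (simp add: dens_eq_cdf)
  qed
  ultimately show ?thesis by simp
qed

end

theorem mainTheorem1:
  fixes M :: "'a measure" and Y :: "'a \<Rightarrow> real" and s :: real
  assumes "prob_space M"
    and "Y \<in> borel_measurable M"
    and "s > 0"
    and "\<And>l::real. integrable M (\<lambda>x. exp (l * Y x))"
    and "\<And>l::real. (\<integral>x. exp (l * Y x) \<partial>M)
           = exp (s * (LBINT t:{0<..<1}. (exp (l * t) - 1) / t))"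
  shows "\<exists>f :: real \<Rightarrow> real.
           f \<in> borel_measurable borel \<and> (\<forall>t. 0 \<le> f t) \<and> (\<forall>t\<le>0. f t = 0) \<and>
           distributed M lborel Y (\<lambda>t. ennreal (f t)) \<and>
           (\<forall>t\<in>{0<..1}. f t = s * t powr (s - 1) * exp (- euler_mascheroni * s) / Gamma (s + 1)) \<and>
           (\<forall>t\<in>{1<..}. f t = s * t powr (s - 1) * exp (- euler_mascheroni * s) / Gamma (s + 1)
               - s * t powr (s - 1) * (LBINT a:{0..t-1}. f a / (1 + a) powr s))"
proof -
  interpret prob_space M by (rule assms(1))
  note [measurable] = assms(2)
  interpret D: dickman_marginal "distr M borel Y" s
  proof (intro dickman_marginal.intro dickman_marginal_axioms.intro)
    show "real_distribution (distr M borel Y)" by simp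
    show "integrable (distr M borel Y) (\<lambda>x. exp (l * x))" for l
      using assms(4) by (simp add: integrable_distr_eq)
    show "(\<integral>x. exp (l * x) \<partial>distr M borel Y)
        = exp (s * (LBINT t:{0<..<1}. (exp (l * t) - 1) / t))" for l
      using assms(5) by (simp add: integral_distr)
  qed (rule assms(3))
  have "distr M lborel Y = distr M borel Y"
    by (rule distr_cong) auto
  then have "distributed M lborel Y (\<lambda>t. ennreal (D.dens t))"
    using D.eq_density_dens by (simp add: distributed_def)
  moreover have "\<forall>t\<in>{0<..1}. D.dens t = s * t powr (s - 1) * exp (- euler_mascheroni * s) / Gamma (s + 1)"
    by (simp add: D.dens_eq_powr D.cdf_1)
  moreover have "\<forall>t\<in>{1<..}. D.dens t = s * t powr (s - 1) * exp (- euler_mascheroni * s) / Gamma (s + 1)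
      - s * t powr (s - 1) * (LBINT a:{0..t-1}. D.dens a / (1 + a) powr s)"
    by (simp add: D.dens_recursion D.cdf_1 right_diff_distrib)
  moreover have "\<forall>t\<le>0. D.dens t = 0"
    by (simp add: D.dens_def)
  ultimately show ?thesis
    using D.measurable_dens D.dens_nonneg by blast
qed

end
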